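(* Let $\tau>0$ and let $\widehat\rho(t)$, $t\in[0,\tau]$, be the normalized density operator of the non-hermitian dynamics generated by $\mathcal{H}(t)=H(t)-i\Gamma(t)$ on a finite-dimensional complex Hilbert space, as described in the context. Let $\mathcal{P}(t):=\mathrm{Tr}[\widehat\rho(t)^2]$ be the purity and let $\Delta_\Gamma(t)$ be the standard deviation of $\Gamma(t)$ in the state $\widehat\rho(t)$. Assume $\int_0^\tau\Delta_\Gamma(t)\,dt\le\pi/2$. Then $$2\sin\left(\int_0^\tau\Delta_\Gamma(t)\,dt\right)\ \ge\ |\mathcal{P}(\tau)-\mathcal{P}(0)|.$$
   Context: Dynamics (units $\hbar=1$): $H(t)$ and $\Gamma(t)$ are hermitian operators depending continuously on $t\in[0,\tau]$, $\mathcal{H}(t):=H(t)-i\Gamma(t)$, and $\rho(t)$ solves $\dot\rho(t)=-i\left(\mathcal{H}(t)\rho(t)-\rho(t)\mathcal{H}^\dagger(t)\right)$ with $\rho(0)$ a density operator. The normalized density operator is $\widehat\rho(t):=\rho(t)/\mathrm{Tr}[\rho(t)]$. For hermitian $X(t)$, $\langle X\rangle(t):=\mathrm{Tr}[X(t)\widehat\rho(t)]$, and $\Delta_\Gamma(t):=\sqrt{\langle\Gamma^2\rangle(t)-\langle\Gamma\rangle(t)^2}$. *)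

theory Defs
  imports "HOL-Analysis.Analysis"
begin

text \<open>
  The finite-dimensional complex Hilbert space is \<open>complex^'n\<close> with its standard hermitian inner
  product, and operators on it are matrices of type \<open>complex^'n^'n\<close>. The library inner product on
  \<open>complex^'n\<close> is only the real part of the hermitian one, so the latter is defined here,
  antilinear in the first argument.
\<close>

definition cinner_vec :: "complex^'n \<Rightarrow> complex^'n \<Rightarrow> complex" where
  "cinner_vec v w = (\<Sum>i\<in>UNIV. cnj (v $ i) * w $ i)"

definition dagger :: "complex^'n^'n \<Rightarrow> complex^'n^'n" where
  "dagger A = map_matrix cnj (transpose A)"

definition hermitian :: "complex^'n^'n \<Rightarrow> bool" where
  "hermitian A \<longleftrightarrow> dagger A = A"

text \<open>The library's scalar action \<open>*\<^sub>R\<close> on matrices is by real numbers only.\<close>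

definition cscale :: "complex \<Rightarrow> complex^'n^'n \<Rightarrow> complex^'n^'n" where
  "cscale c A = map_matrix (\<lambda>z. c * z) A"

text \<open>
  In the next definition the inner product is real because of hermiticity.
\<close>

definition density_operator :: "complex^'n^'n \<Rightarrow> bool" where
  "density_operator R \<longleftrightarrow>
     hermitian R \<and> (\<forall>v. 0 \<le> Re (cinner_vec v (R *v v))) \<and> trace R = 1"

definition nonherm_hamiltonian :: "complex^'n^'n \<Rightarrow> complex^'n^'n \<Rightarrow> complex^'n^'n" where
  "nonherm_hamiltonian H G = H - cscale \<i> G"

definition normalized :: "complex^'n^'n \<Rightarrow> complex^'n^'n" where
  "normalized R = cscale (1 / trace R) R"

text \<open>
  The traces in the next definitions are real for hermitian arguments;
  \<^const>\<open>Re\<close> only changes the type.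
\<close>

definition expect :: "complex^'n^'n \<Rightarrow> complex^'n^'n \<Rightarrow> real" where
  "expect X R = Re (trace (X ** R))"

definition std_dev :: "complex^'n^'n \<Rightarrow> complex^'n^'n \<Rightarrow> real" where
  "std_dev X R = sqrt (expect (X ** X) R - (expect X R)\<^sup>2)"

definition purity :: "complex^'n^'n \<Rightarrow> real" where
  "purity R = Re (trace (R ** R))"

end

theory Submission
  imports Defs
begin

text \<open>
  Write \<open>\<rho>' = K \<rho> + \<rho> K\<^sup>\<dagger>\<close> with \<open>K = - i H - \<Gamma>\<close>. This flow preserves hermiticity, positivity and \<open>\<rho> \<noteq> 0\<close>,
  so \<open>R = \<rho> / Tr \<rho>\<close> stays a density operator, and \<open>P = Tr R\<^sup>2\<close> satisfies
  \<open>P' = - 4 (Tr (\<Gamma> R\<^sup>2) - P Tr (\<Gamma> R))\<close>. The bracket is the covariance of \<open>\<Gamma>\<close> and \<open>R\<close> in the state \<open>R\<close>;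
  since \<open>Tr R\<^sup>3 \<le> P\<close>, Cauchy-Schwarz bounds it by \<open>\<Delta> sqrt (P (1 - P))\<close>. Hence \<open>arcsin (2 P - 1)\<close> changes
  by at most \<open>4 \<theta>\<close> with \<open>\<theta> = \<integral> \<Delta>\<close>, which gives \<open>\<bar>P \<tau> - P 0\<bar> \<le> sin (2 \<theta>) \<le> 2 sin \<theta>\<close> if \<open>\<theta> \<le> pi / 4\<close>;
  for larger \<open>\<theta>\<close> the right-hand side exceeds 1. As arcsin is not differentiable at pure states, it is
  applied to \<open>a (2 P - 1)\<close> with \<open>a < 1\<close>, and \<open>a\<close> tends to 1 at the end.
\<close>

subsection \<open>Complex matrices\<close>

lemma dagger_nth [simp]: "dagger A $ i $ j = cnj (A $ j $ i)"
  by (simp add: dagger_def transpose_def)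

lemma cscale_nth [simp]: "cscale c A $ i $ j = c * A $ i $ j"
  by (simp add: cscale_def)

lemma dagger_dagger [simp]: "dagger (dagger A) = A"
  by (simp add: vec_eq_iff)

lemma dagger_mult: "dagger (A ** B) = dagger B ** dagger A"
  by (simp add: vec_eq_iff matrix_matrix_mult_def mult.commute)

lemma dagger_add: "dagger (A + B) = dagger A + dagger B"
  and dagger_diff: "dagger (A - B) = dagger A - dagger B"
  and dagger_scaleR: "dagger (r *\<^sub>R A) = r *\<^sub>R dagger A"
  and dagger_mat_1: "dagger (mat 1) = mat 1"
  by (auto simp: vec_eq_iff mat_def)

lemma linear_dagger: "linear dagger"
  by (intro linearI dagger_add dagger_scaleR)

lemma trace_dagger: "trace (dagger A) = cnj (trace A)"
  by (simp add: trace_def)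

lemma trace_scaleR: "trace (r *\<^sub>R A) = r *\<^sub>R trace (A :: complex^'n^'n)"
  by (simp add: trace_def scaleR_right.sum)

lemma norm_matrix_sq: "(norm (A :: complex^'n^'m))\<^sup>2 = (\<Sum>i\<in>UNIV. \<Sum>j\<in>UNIV. (cmod (A $ i $ j))\<^sup>2)"
  by (simp add: norm_vec_def L2_set_def sum_nonneg)

lemma norm_dagger: "norm (dagger A) = norm A"
proof -
  have "(norm (dagger A))\<^sup>2 = (norm A)\<^sup>2"
    unfolding norm_matrix_sq by (subst sum.swap) simp
  then show ?thesis by simp
qed

text \<open>Cauchy-Schwarz bounds each entry of the product by a row sum of \<open>A\<close> times a
  column sum of \<open>B\<close>. Summed over all entries, these bounds factor into the two squared
  norms, since the norm of the matrix type is the Hilbert-Schmidt norm.\<close>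

lemma norm_matrix_mult_le:
  fixes A :: "complex^'n^'m" and B :: "complex^'p^'n"
  shows "norm (A ** B) \<le> norm A * norm B"
proof -
  have entry: "(cmod ((A ** B) $ i $ j))\<^sup>2
      \<le> (\<Sum>k\<in>UNIV. (cmod (A $ i $ k))\<^sup>2) * (\<Sum>k\<in>UNIV. (cmod (B $ k $ j))\<^sup>2)" for i j
  proof -
    have "cmod ((A ** B) $ i $ j) \<le> (\<Sum>k\<in>UNIV. cmod (A $ i $ k) * cmod (B $ k $ j))"
      unfolding matrix_matrix_mult_def by (auto intro!: sum_norm_le simp: norm_mult)
    then have "(cmod ((A ** B) $ i $ j))\<^sup>2 \<le> (\<Sum>k\<in>UNIV. cmod (A $ i $ k) * cmod (B $ k $ j))\<^sup>2"
      by (rule power_mono) simp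
    also have "\<dots> \<le> (\<Sum>k\<in>UNIV. (cmod (A $ i $ k))\<^sup>2) * (\<Sum>k\<in>UNIV. (cmod (B $ k $ j))\<^sup>2)"
      by (rule Cauchy_Schwarz_ineq_sum)
    finally show ?thesis .
  qed
  have "(norm (A ** B))\<^sup>2 \<le> (\<Sum>i\<in>UNIV. \<Sum>j\<in>UNIV.
      (\<Sum>k\<in>UNIV. (cmod (A $ i $ k))\<^sup>2) * (\<Sum>k\<in>UNIV. (cmod (B $ k $ j))\<^sup>2))"
    unfolding norm_matrix_sq by (intro sum_mono entry)
  also have "\<dots> = (norm A)\<^sup>2 * (\<Sum>j\<in>UNIV. \<Sum>k\<in>UNIV. (cmod (B $ k $ j))\<^sup>2)"
    unfolding norm_matrix_sq sum_distrib_left[symmetric] sum_distrib_right[symmetric] ..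
  also have "(\<Sum>j\<in>UNIV. \<Sum>k\<in>UNIV. (cmod (B $ k $ j))\<^sup>2) = (norm B)\<^sup>2"
    unfolding norm_matrix_sq by (rule sum.swap)
  finally have "(norm (A ** B))\<^sup>2 \<le> (norm A * norm B)\<^sup>2"
    by (simp add: power_mult_distrib)
  then show ?thesis by (rule power2_le_imp_le) simp
qed

lemma bounded_bilinear_matrix_mult:
  "bounded_bilinear ((**) :: complex^'n^'m \<Rightarrow> complex^'p^'n \<Rightarrow> complex^'p^'m)"
proof
  fix r :: real and A :: "complex^'n^'m" and B :: "complex^'p^'n"
  show "r *\<^sub>R A ** B = r *\<^sub>R (A ** B)" "A ** r *\<^sub>R B = r *\<^sub>R (A ** B)"
    by (simp_all add: vec_eq_iff matrix_matrix_mult_def scaleR_right.sum)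
  show "\<exists>K. \<forall>(A :: complex^'n^'m) (B :: complex^'p^'n). norm (A ** B) \<le> norm A * norm B * K"
    by (rule exI[of _ 1]) (simp add: norm_matrix_mult_le)
qed (simp_all add: vec_eq_iff matrix_matrix_mult_def sum.distrib ring_distribs)

lemmas matrix_mult_linear =
  bounded_bilinear.add_left[OF bounded_bilinear_matrix_mult]
  bounded_bilinear.add_right[OF bounded_bilinear_matrix_mult]
  bounded_bilinear.diff_left[OF bounded_bilinear_matrix_mult]
  bounded_bilinear.diff_right[OF bounded_bilinear_matrix_mult]
  bounded_bilinear.scaleR_left[OF bounded_bilinear_matrix_mult]
  bounded_bilinear.scaleR_right[OF bounded_bilinear_matrix_mult]

lemmas continuous_on_matrix_mult [continuous_intros] =
  bounded_bilinear.continuous_on[OF bounded_bilinear_matrix_mult]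

lemma inner_vec_complex: "v \<bullet> w = Re (cinner_vec v w)"
  by (simp add: inner_vec_def cinner_vec_def inner_complex_def)

lemma inner_matrix_trace: "A \<bullet> B = Re (trace (dagger A ** B))" for A :: "complex^'n^'n"
proof -
  have "A \<bullet> B = (\<Sum>i\<in>UNIV. \<Sum>j\<in>UNIV. Re (cnj (A $ i $ j) * B $ i $ j))"
    by (simp add: inner_vec_def inner_complex_def)
  also have "\<dots> = (\<Sum>j\<in>UNIV. \<Sum>i\<in>UNIV. Re (cnj (A $ i $ j) * B $ i $ j))"
    by (rule sum.swap)
  finally show ?thesis
    by (simp add: trace_def matrix_matrix_mult_def)
qed

lemma inner_dagger: "v \<bullet> (A *v w) = (dagger A *v v) \<bullet> w" for A :: "complex^'n^'n"
proof -
  have "v \<bullet> (A *v w) = Re (\<Sum>i\<in>UNIV. \<Sum>j\<in>UNIV. cnj (v $ i) * (A $ i $ j * w $ j))"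
    by (simp add: inner_vec_complex cinner_vec_def matrix_vector_mult_def sum_distrib_left)
  also have "\<dots> = Re (\<Sum>j\<in>UNIV. \<Sum>i\<in>UNIV. cnj (v $ i) * (A $ i $ j * w $ j))"
    by (subst sum.swap) simp
  also have "\<dots> = (dagger A *v v) \<bullet> w"
    by (simp add: inner_vec_complex cinner_vec_def matrix_vector_mult_def sum_distrib_left
        sum_distrib_right mult_ac)
  finally show ?thesis .
qed

lemma hermitian_inner: "hermitian A \<Longrightarrow> v \<bullet> (A *v w) = (A *v v) \<bullet> w"
  by (simp add: inner_dagger hermitian_def)

lemma matrix_vector_mult_scaleR_right: "A *v (r *\<^sub>R v) = r *\<^sub>R (A *v v)"
  and matrix_vector_mult_scaleR_left: "(r *\<^sub>R A) *v v = r *\<^sub>R (A *v v)"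
  for A :: "complex^'n^'m"
  by (simp_all add: vec_eq_iff matrix_vector_mult_def scaleR_right.sum)

text \<open>The diagonal entries of \<open>dagger A ** B ** A\<close> are the form of
  \<open>B\<close> at the columns of \<open>A\<close>. Positivity on vectors thereby passes to
  traces.\<close>

lemma trace_sandwich:
  "Re (trace (dagger A ** B ** A)) = (\<Sum>j\<in>UNIV. column j A \<bullet> (B *v column j A))"
  for A B :: "complex^'n^'n"
proof -
  have "trace (dagger A ** B ** A) = (\<Sum>j\<in>UNIV. cinner_vec (column j A) (B *v column j A))"
    unfolding matrix_mul_assoc[symmetric]
    by (simp add: trace_def matrix_matrix_mult_def matrix_vector_mult_def cinner_vec_def column_def)
  then show ?thesis
    by (simp add: inner_vec_complex)
qed

lemma norm_matrix_vector_le: "norm (A *v v) \<le> norm A * norm v"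
  for A :: "complex^'n^'m"
proof -
  \<comment> \<open>The vector becomes a one-column matrix, so that the bound for matrix products
    applies.\<close>
  define B :: "complex^1^'n" where "B = (\<chi> i j. v $ i)"
  have "norm (A ** B) = norm (A *v v)" "norm B = norm v"
    by (simp_all add: norm_vec_def L2_set_def B_def matrix_matrix_mult_def matrix_vector_mult_def
        UNIV_1)
  then show ?thesis using norm_matrix_mult_le[of A B] by simp
qed

subsection \<open>Positive semidefinite matrices and density operators\<close>

lemma quadratic_nonneg_imp_Cauchy_Schwarz:
  fixes a b c :: real
  assumes "\<And>s. 0 \<le> a + 2 * s * b + s\<^sup>2 * c" and "0 \<le> c"
  shows "b\<^sup>2 \<le> a * c"
proof (cases "c = 0")
  case True
  have "b = 0"
  proof (rule ccontr)
    assume "b \<noteq> 0"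
    \<comment> \<open>At this \<open>s\<close> the assumed nonnegative quantity equals -1.\<close>
    then show False
      using assms(1)[of "- (a + 1) / (2 * b)"] True by (simp add: field_simps)
  qed
  then show ?thesis using True by simp
next
  case False
  \<comment> \<open>The value \<open>- b / c\<close> minimizes the quadratic.\<close>
  have "0 \<le> (a + 2 * (- b / c) * b + (- b / c)\<^sup>2 * c) * c"
    by (rule mult_nonneg_nonneg[OF assms])
  also have "\<dots> = a * c - b\<^sup>2"
    using False by (simp add: field_simps power2_eq_square)
  finally show ?thesis by simp
qed

text \<open>A density operator without the trace condition, which the unnormalized solution does not
  keep. The real inner product suffices, being the real part of the hermitian one.\<close>

definition psd :: "complex^'n^'n \<Rightarrow> bool" where
  "psd R \<longleftrightarrow> hermitian R \<and> (\<forall>v. 0 \<le> v \<bullet> (R *v v))"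

lemma density_operator_iff: "density_operator R \<longleftrightarrow> psd R \<and> trace R = 1"
  by (auto simp: density_operator_def psd_def inner_vec_complex)

lemma psd_Cauchy_Schwarz:
  assumes "psd R"
  shows "(v \<bullet> (R *v w))\<^sup>2 \<le> (v \<bullet> (R *v v)) * (w \<bullet> (R *v w))"
proof (rule quadratic_nonneg_imp_Cauchy_Schwarz)
  fix s :: real
  have "w \<bullet> (R *v v) = v \<bullet> (R *v w)"
    using assms by (metis psd_def hermitian_inner inner_commute)
  then have "(v + s *\<^sub>R w) \<bullet> (R *v (v + s *\<^sub>R w)) =
      v \<bullet> (R *v v) + 2 * s * (v \<bullet> (R *v w)) + s\<^sup>2 * (w \<bullet> (R *v w))"
    by (simp add: algebra_simps power2_eq_square matrix_vector_right_distrib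
        matrix_vector_mult_scaleR_right)
  then show "0 \<le> v \<bullet> (R *v v) + 2 * s * (v \<bullet> (R *v w)) + s\<^sup>2 * (w \<bullet> (R *v w))"
    using assms by (metis psd_def)
qed (use assms in \<open>simp add: psd_def\<close>)

text \<open>The form is homogeneous of degree two. Unit vectors are preferred because the sphere is
  compact, which later yields a first time of degeneracy.\<close>

lemma psd_iff_sphere:
  "psd R \<longleftrightarrow> hermitian R \<and> (\<forall>v. norm v = 1 \<longrightarrow> 0 \<le> v \<bullet> (R *v v))"
proof -
  have "0 \<le> u \<bullet> (R *v u)" if "\<forall>v. norm v = 1 \<longrightarrow> 0 \<le> v \<bullet> (R *v v)" for u
  proof (cases "u = 0")
    case False
    then have "u \<bullet> (R *v u) = (norm u)\<^sup>2 * (sgn u \<bullet> (R *v sgn u))"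
      by (simp add: sgn_div_norm matrix_vector_mult_scaleR_right power2_eq_square field_simps)
    then show ?thesis using that False by (simp add: norm_sgn)
  qed simp
  then show ?thesis by (auto simp: psd_def)
qed

text \<open>Cauchy-Schwarz with left vector \<open>R *v v\<close> bounds the fourth power of its
  norm by 0.\<close>

lemma psd_kernel:
  assumes "psd R" "v \<bullet> (R *v v) = 0"
  shows "R *v v = 0"
  using psd_Cauchy_Schwarz[OF assms(1), of "R *v v" v] assms(2) by simp

lemma matrix_vector_mult_axis: "R *v axis k z = (\<chi> l. R $ l $ k * z)"
  by (simp add: vec_eq_iff matrix_vector_mult_def axis_def if_distrib cong: if_cong)

lemma psd_diagonal_nonneg:
  assumes "psd R" shows "0 \<le> Re (R $ k $ k)"
proof -
  have "0 \<le> axis k 1 \<bullet> (R *v axis k 1)"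
    using assms by (simp add: psd_def)
  then show ?thesis
    by (simp add: inner_axis' matrix_vector_mult_axis inner_complex_def)
qed

lemma cmod_entry_le_psd:
  assumes "psd R"
  shows "(cmod (R $ i $ j))\<^sup>2 \<le> Re (R $ i $ i) * Re (R $ j $ j)"
proof (cases "R $ i $ j = 0")
  case True
  then show ?thesis using assms by (simp add: psd_diagonal_nonneg)
next
  case False
  let ?z = "R $ i $ j"
  \<comment> \<open>The real inner product sees only real parts. Putting the entry itself into the
    left vector cancels its phase and makes the form equal to its squared modulus.\<close>
  have "((cmod ?z)\<^sup>2)\<^sup>2 = (axis i ?z \<bullet> (R *v axis j 1))\<^sup>2"
    by (simp add: inner_axis' matrix_vector_mult_axis inner_complex_def
        flip: power2_eq_square cmod_power2)
  also have "\<dots> \<le> (axis i ?z \<bullet> (R *v axis i ?z)) * (axis j 1 \<bullet> (R *v axis j 1))"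
    by (rule psd_Cauchy_Schwarz[OF assms])
  also have "\<dots> = (cmod ?z)\<^sup>2 * (Re (R $ i $ i) * Re (R $ j $ j))"
    by (simp add: inner_axis' matrix_vector_mult_axis inner_complex_def cmod_power2)
       (simp add: algebra_simps power2_eq_square)
  finally have "(cmod ?z)\<^sup>2 * (cmod ?z)\<^sup>2 \<le> (cmod ?z)\<^sup>2 * (Re (R $ i $ i) * Re (R $ j $ j))"
    by (simp add: power2_eq_square)
  then show ?thesis by (rule mult_left_le_imp_le) (use False in simp)
qed

lemma psd_trace_nonneg: "psd R \<Longrightarrow> 0 \<le> Re (trace R)"
  by (simp add: trace_def sum_nonneg psd_diagonal_nonneg)

text \<open>The entrywise bounds by products of diagonal entries add up to the square of the trace.
  This makes the trace of a nonzero \<open>R\<close> positive and bounds the norm of a density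
  operator by 1.\<close>

lemma norm_psd_le_trace:
  assumes "psd R" shows "norm R \<le> Re (trace R)"
proof (rule power2_le_imp_le)
  have "(norm R)\<^sup>2 \<le> (\<Sum>i\<in>UNIV. \<Sum>j\<in>UNIV. Re (R $ i $ i) * Re (R $ j $ j))"
    unfolding norm_matrix_sq by (intro sum_mono cmod_entry_le_psd assms)
  also have "\<dots> = (Re (trace R))\<^sup>2"
    by (simp add: trace_def power2_eq_square sum_product)
  finally show "(norm R)\<^sup>2 \<le> (Re (trace R))\<^sup>2" .
qed (rule psd_trace_nonneg[OF assms])

lemma hermitian_trace_real: "hermitian R \<Longrightarrow> trace R = of_real (Re (trace R))"
  by (metis Reals_cnj_iff hermitian_def of_real_Re trace_dagger)

lemma normalized_hermitian:
  assumes "hermitian R" shows "normalized R = (1 / Re (trace R)) *\<^sub>R R"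
  unfolding normalized_def
  by (subst hermitian_trace_real[OF assms], simp only: vec_eq_iff cscale_nth vector_scaleR_component)
     (simp add: scaleR_conv_of_real)

lemma purity_hermitian: "hermitian R \<Longrightarrow> purity R = (norm R)\<^sup>2"
  by (simp add: purity_def hermitian_def power2_norm_eq_inner inner_matrix_trace)

lemma density_normalized:
  assumes "psd R" "R \<noteq> 0"
  shows "density_operator (normalized R)"
proof -
  have herm: "hermitian R" using assms by (simp add: psd_def)
  have pos: "0 < Re (trace R)"
    using norm_psd_le_trace[OF assms(1)] assms(2) by (meson less_le_trans zero_less_norm_iff)
  have "trace (normalized R) = 1"
    unfolding normalized_hermitian[OF herm] trace_scaleR
    by (subst (2) hermitian_trace_real[OF herm]) (use pos in \<open>simp add: scaleR_conv_of_real\<close>)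
  moreover have "psd (normalized R)"
    unfolding normalized_hermitian[OF herm]
    using assms(1) pos
    by (simp add: psd_def hermitian_def dagger_scaleR matrix_vector_mult_scaleR_left)
  ultimately show ?thesis by (simp add: density_operator_iff)
qed

lemma purity_le_1: "density_operator R \<Longrightarrow> purity R \<le> 1"
  using norm_psd_le_trace[of R]
  by (simp add: density_operator_iff purity_hermitian psd_def power_le_one)

section \<open>Cauchy-Schwarz in a state and the covariance of an observable with the state\<close>

lemma psd_trace_sandwich_nonneg:
  assumes "psd R" "hermitian A"
  shows "0 \<le> Re (trace (A ** A ** R))"
proof -
  have "trace (A ** A ** R) = trace (dagger A ** R ** A)"
    using assms(2) by (metis hermitian_def matrix_mul_assoc trace_mul_sym)
  then show ?thesis
    using assms(1) by (simp add: trace_sandwich psd_def sum_nonneg)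
qed

text \<open>On hermitian matrices, the real part of Tr(A B R) is a positive semidefinite real
  bilinear form. It is symmetric because Tr(B A R) is the complex conjugate of Tr(A B R).\<close>

lemma psd_trace_Cauchy_Schwarz:
  assumes R: "psd R" and A: "hermitian A" and B: "hermitian B"
  shows "(Re (trace (A ** B ** R)))\<^sup>2 \<le> Re (trace (A ** A ** R)) * Re (trace (B ** B ** R))"
proof (rule quadratic_nonneg_imp_Cauchy_Schwarz)
  fix s :: real
  have "trace (B ** A ** R) = trace (R ** B ** A)"
    by (metis matrix_mul_assoc trace_mul_sym)
  also have "\<dots> = cnj (trace (A ** B ** R))"
    using assms unfolding trace_dagger[symmetric] dagger_mult psd_def hermitian_def
    by (simp add: matrix_mul_assoc)
  finally have BA: "Re (trace (B ** A ** R)) = Re (trace (A ** B ** R))" by simp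
  have "hermitian (A + s *\<^sub>R B)"
    using A B by (simp add: hermitian_def dagger_add dagger_scaleR)
  from psd_trace_sandwich_nonneg[OF R this]
  show "0 \<le> Re (trace (A ** A ** R)) + 2 * s * Re (trace (A ** B ** R))
      + s\<^sup>2 * Re (trace (B ** B ** R))"
    by (simp add: matrix_mult_linear trace_add trace_scaleR BA power2_eq_square algebra_simps)
qed (rule psd_trace_sandwich_nonneg[OF R B])

text \<open>Read Tr R^3 as the inner product of R and R^2. Cauchy-Schwarz, submultiplicativity and
  \<open>norm R \<le> 1\<close> then replace any use of eigenvalues.\<close>

lemma density_trace_cube_le:
  assumes "density_operator R"
  shows "Re (trace (R ** R ** R)) \<le> purity R"
proof -
  have R: "hermitian R" "norm R \<le> 1"
    using assms norm_psd_le_trace[of R] by (auto simp: density_operator_iff psd_def)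
  have "Re (trace (R ** R ** R)) = R \<bullet> (R ** R)"
    using R(1) by (simp add: inner_matrix_trace hermitian_def matrix_mul_assoc)
  also have "\<dots> \<le> norm R * norm (R ** R)" by (rule norm_cauchy_schwarz)
  also have "\<dots> \<le> 1 * (norm R * norm R)"
    using R(2) by (intro mult_mono norm_matrix_mult_le) auto
  finally show ?thesis using R(1) by (simp add: purity_hermitian power2_eq_square)
qed

lemma variance_eq:
  assumes "density_operator R"
  shows "expect (G ** G) R - (expect G R)\<^sup>2 =
    Re (trace ((G - expect G R *\<^sub>R mat 1) ** (G - expect G R *\<^sub>R mat 1) ** R))"
  using assms
  by (simp add: matrix_mult_linear trace_sub trace_scaleR expect_def density_operator_def
      power2_eq_square)

lemma variance_nonneg:
  assumes "density_operator R" "hermitian G"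
  shows "0 \<le> expect (G ** G) R - (expect G R)\<^sup>2"
  unfolding variance_eq[OF assms(1)] using assms
  by (intro psd_trace_sandwich_nonneg)
     (simp_all add: density_operator_iff hermitian_def dagger_diff dagger_scaleR dagger_mat_1)

lemma covariance_purity_bound:
  assumes R: "density_operator R" and G: "hermitian G"
  shows "\<bar>Re (trace (G ** R ** R)) - purity R * expect G R\<bar>
    \<le> std_dev G R * sqrt (purity R * (1 - purity R))"
proof -
  \<comment> \<open>Both observables are centred in the state \<open>R\<close>; the mean of
    \<open>R\<close> in its own state is the purity.\<close>
  define A where "A = G - expect G R *\<^sub>R mat 1"
  define B where "B = R - purity R *\<^sub>R mat 1"
  have psd: "psd R" and tr: "trace R = 1" and hR: "hermitian R"
    using R by (auto simp: density_operator_iff psd_def)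
  have herm: "hermitian A" "hermitian B"
    using G hR by (simp_all add: A_def B_def hermitian_def dagger_diff dagger_scaleR dagger_mat_1)
  have cov: "Re (trace (A ** B ** R)) = Re (trace (G ** R ** R)) - purity R * expect G R"
    using tr by (simp add: A_def B_def matrix_mult_linear trace_sub trace_scaleR expect_def
        purity_def)
  have "Re (trace (B ** B ** R)) = Re (trace (R ** R ** R)) - (purity R)\<^sup>2"
    using tr by (simp add: B_def matrix_mult_linear trace_sub trace_scaleR purity_def
        power2_eq_square)
  also have "\<dots> \<le> purity R * (1 - purity R)"
    using density_trace_cube_le[OF R] by (simp add: algebra_simps power2_eq_square)
  finally have BB: "Re (trace (B ** B ** R)) \<le> purity R * (1 - purity R)" .
  have "(Re (trace (A ** B ** R)))\<^sup>2 \<le> Re (trace (A ** A ** R)) * Re (trace (B ** B ** R))"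
    by (rule psd_trace_Cauchy_Schwarz[OF psd herm])
  also have "\<dots> \<le> Re (trace (A ** A ** R)) * (purity R * (1 - purity R))"
    by (intro mult_left_mono BB psd_trace_sandwich_nonneg psd herm)
  finally have "\<bar>Re (trace (A ** B ** R))\<bar> \<le> sqrt (Re (trace (A ** A ** R)) * (purity R * (1 - purity R)))"
    by (rule real_le_rsqrt[of "\<bar>_\<bar>", simplified])
  then show ?thesis
    unfolding cov std_dev_def variance_eq[OF R] A_def[symmetric] real_sqrt_mult .
qed

lemma bounded_bilinear_matrix_vector_mult:
  "bounded_bilinear ((*v) :: complex^'n^'m \<Rightarrow> complex^'n \<Rightarrow> complex^'m)"
proof
  show "\<exists>K. \<forall>(A :: complex^'n^'m) v. norm (A *v v) \<le> norm A * norm v * K"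
    by (rule exI[of _ 1]) (simp add: norm_matrix_vector_le)
qed (simp_all add: matrix_vector_mult_scaleR_left matrix_vector_mult_scaleR_right
    matrix_vector_right_distrib matrix_vector_mult_add_rdistrib)

subsection \<open>Congruence flows\<close>

text \<open>Gronwall: \<open>f t * exp (- (c * t))\<close> is nonincreasing. Neither
  \<open>f\<close> nor \<open>c\<close> has a prescribed sign, so the lemma also gives lower bounds
  when applied to a negated function.\<close>

lemma differential_inequality_exp_bound:
  fixes f :: "real \<Rightarrow> real"
  assumes deriv: "\<And>t. t \<in> {0..\<tau>} \<Longrightarrow> (f has_real_derivative f' t) (at t within {0..\<tau>})"
    and le: "\<And>t. t \<in> {0..\<tau>} \<Longrightarrow> f' t \<le> c * f t"
    and s: "s \<in> {0..\<tau>}"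
  shows "f s \<le> exp (c * s) * f 0"
proof -
  define g where "g t = f t * exp (- (c * t))" for t
  have g: "(g has_real_derivative (f' t - c * f t) * exp (- (c * t))) (at t within {0..\<tau>})"
    if "t \<in> {0..\<tau>}" for t
    unfolding g_def using deriv[OF that]
    by (auto intro!: derivative_eq_intros simp: algebra_simps)
  have "g s \<le> g 0"
  proof (rule DERIV_nonpos_imp_decreasing_open[where f = g])
    fix t assume t: "0 < t" "t < s"
    then have "(g has_real_derivative (f' t - c * f t) * exp (- (c * t))) (at t)"
      using g[of t] s by (simp add: at_within_Icc_at)
    moreover have "(f' t - c * f t) * exp (- (c * t)) \<le> 0"
      using le[of t] t s by (intro mult_nonpos_nonneg) auto
    ultimately show "\<exists>y. (g has_real_derivative y) (at t) \<and> y \<le> 0" by blast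
  next
    have "continuous_on {0..\<tau>} g"
      using g by (intro DERIV_continuous_on)
    then show "continuous_on {0..s} g"
      by (rule continuous_on_subset) (use s in auto)
  qed (use s in auto)
  then have "g s * exp (c * s) \<le> f 0 * exp (c * s)"
    by (intro mult_right_mono) (simp_all add: g_def)
  moreover have "g s * exp (c * s) = f s"
    by (simp add: g_def mult.assoc flip: exp_add)
  ultimately show ?thesis by (simp add: mult.commute)
qed

text \<open>The equation is the infinitesimal form of a congruence
  \<open>V ** X ** dagger V\<close>. Keeping \<open>X\<close> abstract lets the same facts serve the
  solution and the difference \<open>X t - dagger (X t)\<close>.\<close>

locale congruence_flow =
  fixes K X :: "real \<Rightarrow> complex^'n^'n" and \<tau> c :: real
  assumes ode: "\<And>t. t \<in> {0..\<tau>} \<Longrightarrow>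
      (X has_vector_derivative K t ** X t + X t ** dagger (K t)) (at t within {0..\<tau>})"
    and bound: "\<And>t. t \<in> {0..\<tau>} \<Longrightarrow> norm (K t) \<le> c"
begin

lemma continuous_on_X: "continuous_on {0..\<tau>} X"
  unfolding continuous_on_eq_continuous_within
  by (blast intro: has_vector_derivative_continuous ode)

lemma norm_sq_deriv:
  assumes "t \<in> {0..\<tau>}"
  shows "((\<lambda>t. (norm (X t))\<^sup>2) has_real_derivative
      2 * (X t \<bullet> (K t ** X t + X t ** dagger (K t)))) (at t within {0..\<tau>})"
  using bounded_bilinear.has_vector_derivative[OF bounded_bilinear_inner ode[OF assms] ode[OF assms]]
  by (simp add: has_real_derivative_iff_has_vector_derivative power2_norm_eq_inner inner_commute)

lemma norm_sq_deriv_bound: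
  assumes "t \<in> {0..\<tau>}"
  shows "\<bar>2 * (X t \<bullet> (K t ** X t + X t ** dagger (K t)))\<bar> \<le> 4 * c * (norm (X t))\<^sup>2"
proof -
  have "norm (K t ** X t + X t ** dagger (K t)) \<le> norm (K t) * norm (X t) + norm (X t) * norm (K t)"
    using norm_matrix_mult_le[of "K t" "X t"] norm_matrix_mult_le[of "X t" "dagger (K t)"]
    by (intro norm_triangle_le add_mono) (simp_all add: norm_dagger)
  also have "\<dots> = 2 * (norm (K t) * norm (X t))" by simp
  also have "\<dots> \<le> 2 * c * norm (X t)"
    using mult_right_mono[OF bound[OF assms], of "norm (X t)"] by simp
  finally have "norm (X t) * norm (K t ** X t + X t ** dagger (K t)) \<le> norm (X t) * (2 * c * norm (X t))"
    by (intro mult_left_mono) auto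
  then show ?thesis
    using Cauchy_Schwarz_ineq2[of "X t" "K t ** X t + X t ** dagger (K t)"]
    by (simp add: power2_eq_square algebra_simps)
qed

lemma zero_preserved:
  assumes "X 0 = 0" "t \<in> {0..\<tau>}" shows "X t = 0"
proof -
  have "(norm (X t))\<^sup>2 \<le> exp (4 * c * t) * (norm (X 0))\<^sup>2"
    using norm_sq_deriv_bound
    by (intro differential_inequality_exp_bound[OF norm_sq_deriv _ assms(2)])
       (auto simp: abs_le_iff)
  then show ?thesis using assms by simp
qed

text \<open>Gronwall for the negated squared norm: the solution can decay at most exponentially, so
  it never reaches 0.\<close>

lemma nonzero_preserved:
  assumes "X 0 \<noteq> 0" "t \<in> {0..\<tau>}" shows "X t \<noteq> 0"
proof -
  have "- (norm (X t))\<^sup>2 \<le> exp (- 4 * c * t) * - (norm (X 0))\<^sup>2"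
    using norm_sq_deriv_bound
    by (intro differential_inequality_exp_bound[OF DERIV_minus[OF norm_sq_deriv] _ assms(2)])
       (auto simp: abs_le_iff)
  moreover have "0 < exp (- 4 * c * t) * (norm (X 0))\<^sup>2" using assms by simp
  ultimately show ?thesis by (metis mult_minus_right neg_le_iff_le norm_zero not_less zero_power2)
qed

text \<open>The antihermitian difference \<open>X t - dagger (X t)\<close> solves the same linear
  equation and starts at 0.\<close>

lemma hermitian_preserved:
  assumes "hermitian (X 0)" "t \<in> {0..\<tau>}" shows "hermitian (X t)"
proof -
  interpret D: congruence_flow K "\<lambda>t. X t - dagger (X t)" \<tau> c
  proof
    fix t assume t: "t \<in> {0..\<tau>}"
    show "((\<lambda>t. X t - dagger (X t)) has_vector_derivative
        K t ** (X t - dagger (X t)) + (X t - dagger (X t)) ** dagger (K t)) (at t within {0..\<tau>})"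
      using has_vector_derivative_diff[OF ode[OF t] bounded_linear.has_vector_derivative[
            OF linear_dagger[unfolded linear_conv_bounded_linear] ode[OF t]]]
      by (simp add: dagger_add dagger_mult matrix_mult_linear algebra_simps)
  qed (rule bound)
  show ?thesis
    using D.zero_preserved[OF _ assms(2)] assms(1) by (simp add: hermitian_def)
qed

text \<open>
  At the first time at which \<open>Y = X + \<epsilon> exp ((2 * c + 1) * t) 1\<close> is singular, \<open>Y\<close> is positive
  semidefinite, so a unit vector \<open>v\<close> with \<open>v \<bullet> Y v = 0\<close> lies in the kernel of \<open>Y\<close> and is thus an
  eigenvector of \<open>X\<close>. This makes the derivative of \<open>v \<bullet> Y v\<close> positive there, which is impossible.
\<close>

lemma psd_perturbed:
  assumes psd0: "psd (X 0)" and \<epsilon>: "0 < \<epsilon>" and t: "t \<in> {0..\<tau>}" and v: "norm v = 1"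
  shows "0 < v \<bullet> ((X t + (\<epsilon> * exp ((2 * c + 1) * t)) *\<^sub>R mat 1) *v v)"
proof (rule ccontr)
  \<comment> \<open>The form of \<open>K\<close> at a unit vector is at most \<open>c\<close>, so at
    the critical point the flow can lower the form of \<open>Y\<close> at rate at most
    \<open>2 * c * e\<close>. Growth of \<open>e\<close> at rate \<open>2 * c + 1\<close> outweighs
    this.\<close>
  define e where "e t = \<epsilon> * exp ((2 * c + 1) * t)" for t
  define Y where "Y t = X t + e t *\<^sub>R mat 1" for t
  define F where "F p = snd p \<bullet> (Y (fst p) *v snd p)" for p
  \<comment> \<open>Pairs of a time and a unit vector at which positivity of \<open>Y\<close> fails.
    Compactness of this set provides an earliest such time.\<close>
  define S where "S = {p \<in> {0..\<tau>} \<times> sphere 0 1. F p \<in> {..0}}"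
  have Yv: "Y t *v w = X t *v w + e t *\<^sub>R w" for t w
    by (simp add: Y_def matrix_vector_mult_add_rdistrib matrix_vector_mult_scaleR_left)
  have e_pos: "0 < e t" for t using \<epsilon> by (simp add: e_def)
  have contY: "continuous_on {0..\<tau>} Y"
    unfolding Y_def e_def by (intro continuous_intros continuous_on_X)
  have contF: "continuous_on ({0..\<tau>} \<times> sphere 0 1) F"
    unfolding F_def
    by (intro continuous_intros bounded_bilinear.continuous_on[OF bounded_bilinear_matrix_vector_mult]
        continuous_on_compose2[OF contY]) auto
  assume "\<not> ?thesis"
  then have "(t, v) \<in> S"
    using t v by (simp add: S_def F_def Y_def e_def)
  then have nonempty: "S \<noteq> {}" by blast
  have compact: "compact S"
  proof -
    have "closed S"
      unfolding S_def Collect_conj_eq Collect_mem_eq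
      using continuous_closed_preimage[OF contF, of "{..0}"]
      by (simp add: vimage_def closed_Times)
    moreover have "S \<subseteq> {0..\<tau>} \<times> sphere 0 1" by (auto simp: S_def)
    ultimately show ?thesis
      by (metis compact_Int_closed compact_Times compact_Icc compact_sphere inf.absorb2)
  qed
  obtain p where p: "p \<in> S" "\<And>q. q \<in> S \<Longrightarrow> fst p \<le> fst q"
    using continuous_attains_inf[OF compact nonempty continuous_on_fst[OF continuous_on_id]] by blast
  obtain s w where p_eq: "p = (s, w)" by (cases p)
  have s: "s \<in> {0..\<tau>}" and w: "norm w = 1" and le0: "w \<bullet> (Y s *v w) \<le> 0"
    using p(1) by (auto simp: S_def F_def p_eq)
  have before: "0 < u \<bullet> (Y r *v u)" if "r \<in> {0..<s}" "norm u = 1" for r u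
    using p(2)[of "(r, u)"] that s by (force simp: S_def F_def p_eq)
  have "s \<noteq> 0"
  proof
    assume "s = 0"
    have "w \<bullet> (Y 0 *v w) = w \<bullet> (X 0 *v w) + e 0"
      using w by (simp add: Yv inner_add_right dot_square_norm)
    then show False using le0 \<open>s = 0\<close> psd0 e_pos[of 0] by (simp add: psd_def) (smt (verit))
  qed
  then have s_pos: "0 < s" using s by simp
  \<comment> \<open>Strict positivity before time \<open>s\<close> survives as nonnegativity at
    \<open>s\<close> by continuity.\<close>
  have nonneg: "0 \<le> u \<bullet> (Y s *v u)" if "norm u = 1" for u
  proof (rule continuous_ge_on_closure[of "{0..<s}" "\<lambda>r. u \<bullet> (Y r *v u)"])
    show "continuous_on (closure {0..<s}) (\<lambda>r. u \<bullet> (Y r *v u))"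
      using s s_pos
      by (intro continuous_intros continuous_on_subset[OF contY]
          bounded_bilinear.continuous_on[OF bounded_bilinear_matrix_vector_mult]) auto
  qed (use s_pos before[OF _ that] less_imp_le in auto)
  have "hermitian (X s)"
    using hermitian_preserved[OF _ s] psd0 by (simp add: psd_def)
  then have psdY: "psd (Y s)"
    using nonneg by (simp add: psd_iff_sphere hermitian_def Y_def dagger_add dagger_scaleR dagger_mat_1)
  have Y0: "w \<bullet> (Y s *v w) = 0" using le0 nonneg[OF w] by simp
  have "Y s *v w = 0" by (rule psd_kernel[OF psdY Y0])
  then have Xw: "X s *v w = - (e s *\<^sub>R w)" by (simp add: Yv eq_neg_iff_add_eq_0)
  let ?Y' = "K s ** X s + X s ** dagger (K s) + (e s * (2 * c + 1)) *\<^sub>R mat 1"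
  have "(e has_vector_derivative e s * (2 * c + 1)) (at s within {0..\<tau>})"
    unfolding e_def has_real_derivative_iff_has_vector_derivative[symmetric]
    by (auto intro!: derivative_eq_intros)
  then have "(Y has_vector_derivative ?Y') (at s within {0..\<tau>})"
    unfolding Y_def
    using has_vector_derivative_add[OF ode[OF s] bounded_linear.has_vector_derivative[
        OF bounded_linear_scaleR_left, of e _ _ "mat 1"]] by blast
  then have "((\<lambda>r. w \<bullet> (Y r *v w)) has_vector_derivative w \<bullet> (?Y' *v w)) (at s within {0..\<tau>})"
    by (intro bounded_linear.has_vector_derivative[OF bounded_linear_inner_right]
        bounded_linear.has_vector_derivative[OF
          bounded_bilinear.bounded_linear_left[OF bounded_bilinear_matrix_vector_mult]])
  then have deriv: "((\<lambda>r. w \<bullet> (Y r *v w)) has_real_derivative w \<bullet> (?Y' *v w)) (at s within {0..\<tau>})"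
    by (simp add: has_real_derivative_iff_has_vector_derivative)
  \<comment> \<open>As \<open>w\<close> is an eigenvector of \<open>X s\<close> with eigenvalue
    \<open>- e s\<close>, both terms of the flow reduce to the form of \<open>K s\<close> at
    \<open>w\<close>.\<close>
  have "w \<bullet> (X s *v (dagger (K s) *v w)) = - (e s * (w \<bullet> (K s *v w)))"
    using \<open>hermitian (X s)\<close>
    by (simp add: hermitian_inner Xw inner_dagger[of _ "K s"] inner_commute)
  moreover have "w \<bullet> (K s *v (X s *v w)) = - (e s * (w \<bullet> (K s *v w)))"
    by (simp add: Xw matrix_vector_mult_scaleR_right flip: scaleR_minus_left)
  ultimately have "w \<bullet> (?Y' *v w) = e s * (2 * c + 1 - 2 * (w \<bullet> (K s *v w)))"
    using w by (simp add: matrix_vector_mult_add_rdistrib matrix_vector_mult_scaleR_left inner_add_right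
        dot_square_norm algebra_simps flip: matrix_vector_mul_assoc)
  moreover have "w \<bullet> (K s *v w) \<le> c"
    using norm_cauchy_schwarz[of w "K s *v w"] norm_matrix_vector_le[of "K s" w] bound[OF s] w
    by simp
  ultimately have "0 < w \<bullet> (?Y' *v w)"
    using e_pos[of s] by simp
  \<comment> \<open>A positive derivative at a zero forces negative values just before
    \<open>s\<close>, contradicting \<open>before\<close>.\<close>
  from has_real_derivative_pos_inc_left[OF deriv this]
  obtain d where d: "0 < d" "\<And>h. 0 < h \<Longrightarrow> s - h \<in> {0..\<tau>} \<Longrightarrow> h < d \<Longrightarrow>
      w \<bullet> (Y (s - h) *v w) < w \<bullet> (Y s *v w)" by blast
  define h where "h = min s d / 2"
  have h: "0 < h" "h < d" "s - h \<in> {0..<s}" using s_pos d(1) by (auto simp: h_def)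
  then show False
    using d(2)[of h] before[OF h(3) w] Y0 s by auto
qed

lemma psd_preserved:
  assumes psd0: "psd (X 0)" and t: "t \<in> {0..\<tau>}"
  shows "psd (X t)"
proof -
  have unit: "0 \<le> v \<bullet> (X t *v v)" if v: "norm v = 1" for v
  proof (rule ccontr)
    let ?a = "v \<bullet> (X t *v v)" and ?b = "exp ((2 * c + 1) * t)"
    assume "\<not> 0 \<le> ?a"
    \<comment> \<open>With this value as \<epsilon>, the perturbed form at \<open>v\<close> is
      exactly 0, although it must be strictly positive.\<close>
    then have "0 < - ?a / ?b" by (intro divide_pos_pos) auto
    from psd_perturbed[OF psd0 this t v] v show False
      by (simp add: matrix_vector_mult_diff_rdistrib matrix_vector_mult_scaleR_left inner_diff_right
          dot_square_norm)
  qed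
  then show ?thesis
    using hermitian_preserved[OF _ t] psd0 by (simp add: psd_iff_sphere)
qed

end

section \<open>Trace and purity along the flow\<close>

lemma inner_hermitian_congruence:
  assumes R: "hermitian R" and G: "K + dagger K = - (2 *\<^sub>R G)"
  shows "R \<bullet> (K ** R + R ** dagger K) = - 2 * Re (trace (G ** R ** R))"
proof -
  have "R \<bullet> (K ** R + R ** dagger K) = Re (trace (R ** (K ** R)) + trace (R ** (R ** dagger K)))"
    using R by (simp add: inner_matrix_trace hermitian_def trace_add matrix_add_ldistrib)
  \<comment> \<open>Cyclicity collects both terms into \<open>K + dagger K\<close>, from which the
    antihermitian part of \<open>K\<close>, the one generated by the Hamiltonian, has
    cancelled.\<close>
  also have "trace (R ** (K ** R)) = trace (K ** (R ** R))"
    by (metis matrix_mul_assoc trace_mul_sym)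
  also have "trace (R ** (R ** dagger K)) = trace (dagger K ** (R ** R))"
    by (metis matrix_mul_assoc trace_mul_sym)
  also have "trace (K ** (R ** R)) + trace (dagger K ** (R ** R)) = trace ((K + dagger K) ** (R ** R))"
    by (simp add: matrix_mult_linear trace_add)
  finally show ?thesis
    unfolding G by (simp add: matrix_mult_linear trace_scaleR matrix_mul_assoc flip: scaleR_minus_left)
qed

lemma trace_congruence:
  assumes "K + dagger K = - (2 *\<^sub>R G)"
  shows "Re (trace (K ** R + R ** dagger K)) = - 2 * Re (trace (G ** R))"
proof -
  have "trace (K ** R + R ** dagger K) = trace ((K + dagger K) ** R)"
    by (simp add: matrix_mult_linear trace_add trace_mul_sym[of R])
  then show ?thesis
    unfolding assms by (simp add: matrix_mult_linear trace_scaleR flip: scaleR_minus_left)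
qed

lemma bounded_linear_Re_trace: "bounded_linear (\<lambda>A :: complex^'n^'n. Re (trace A))"
  unfolding linear_conv_bounded_linear[symmetric]
  by (intro linearI) (simp_all add: trace_add trace_scaleR)

context congruence_flow
begin

lemma psd_nonzero:
  assumes "density_operator (X 0)" "t \<in> {0..\<tau>}"
  shows "psd (X t)" "X t \<noteq> 0"
proof -
  have "X 0 \<noteq> 0" using assms(1) by (auto simp: density_operator_iff trace_def)
  then show "X t \<noteq> 0" by (rule nonzero_preserved[OF _ assms(2)])
  show "psd (X t)" using assms by (simp add: psd_preserved density_operator_iff)
qed

lemma density_operator_normalized:
  assumes "density_operator (X 0)" "t \<in> {0..\<tau>}"
  shows "density_operator (normalized (X t))"
  by (rule density_normalized[OF psd_nonzero[OF assms]])

lemma normalized_eq: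
  assumes "density_operator (X 0)" "t \<in> {0..\<tau>}"
  shows "normalized (X t) = (1 / Re (trace (X t))) *\<^sub>R X t"
  using psd_nonzero(1)[OF assms] by (simp add: normalized_hermitian psd_def)

lemma trace_pos:
  assumes "density_operator (X 0)" "t \<in> {0..\<tau>}"
  shows "0 < Re (trace (X t))"
  using norm_psd_le_trace psd_nonzero[OF assms] by (meson less_le_trans zero_less_norm_iff)

lemma continuous_on_normalized:
  assumes "density_operator (X 0)"
  shows "continuous_on {0..\<tau>} (\<lambda>t. normalized (X t))"
proof -
  have "continuous_on {0..\<tau>} (\<lambda>t. (1 / Re (trace (X t))) *\<^sub>R X t)"
    using trace_pos[OF assms]
    by (intro continuous_intros continuous_on_X
        bounded_linear.continuous_on[OF bounded_linear_Re_trace]) fastforce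
  then show ?thesis
    by (rule continuous_on_eq) (simp add: normalized_eq[OF assms])
qed

lemma purity_deriv:
  assumes X0: "density_operator (X 0)" and t: "t \<in> {0..\<tau>}"
    and G: "K t + dagger (K t) = - (2 *\<^sub>R G)"
  defines "R \<equiv> normalized (X t)"
  shows "((\<lambda>t. purity (normalized (X t))) has_real_derivative
      - 4 * (Re (trace (G ** R ** R)) - purity R * expect G R)) (at t within {0..\<tau>})"
proof -
  let ?r = "\<lambda>t. Re (trace (X t))"
  have herm: "hermitian (X s)" if "s \<in> {0..\<tau>}" for s
    using hermitian_preserved[OF _ that] X0 by (simp add: density_operator_def)
  have r: "0 < ?r s" if "s \<in> {0..\<tau>}" for s by (rule trace_pos[OF X0 that])
  have purity_eq: "purity (normalized (X s)) = (norm (X s))\<^sup>2 / (?r s)\<^sup>2" if s: "s \<in> {0..\<tau>}" for s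
  proof -
    have "hermitian (normalized (X s))"
      using density_operator_normalized[OF X0 s] by (simp add: density_operator_def)
    then show ?thesis
      by (simp add: purity_hermitian normalized_eq[OF X0 s] power_divide)
  qed
  have dn: "((\<lambda>t. (norm (X t))\<^sup>2) has_real_derivative - 4 * Re (trace (G ** X t ** X t)))
      (at t within {0..\<tau>})"
    using norm_sq_deriv[OF t] by (simp add: inner_hermitian_congruence[OF herm[OF t] G])
  have dr: "(?r has_real_derivative - 2 * Re (trace (G ** X t))) (at t within {0..\<tau>})"
    using bounded_linear.has_vector_derivative[OF bounded_linear_Re_trace ode[OF t]]
    by (simp add: has_real_derivative_iff_has_vector_derivative trace_congruence[OF G])
  have moments: "Re (trace (G ** R ** R)) = Re (trace (G ** X t ** X t)) / (?r t)\<^sup>2"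
    "expect G R = Re (trace (G ** X t)) / ?r t"
    unfolding R_def normalized_eq[OF X0 t] expect_def
    by (simp_all add: matrix_mult_linear trace_scaleR power2_eq_square)
  have dr2: "((\<lambda>t. (?r t)\<^sup>2) has_real_derivative - 4 * ?r t * Re (trace (G ** X t))) (at t within {0..\<tau>})"
    using DERIV_power[OF dr, of 2] by (simp add: mult_ac)
  \<comment> \<open>Here \<open>a\<close> and \<open>b\<close> stand for the traces of
    \<open>G ** X t ** X t\<close> and \<open>G ** X t\<close>, \<open>n\<close> for the squared
    norm and \<open>r\<close> for the trace of \<open>X t\<close>. The derivative of the trace
    produces the product of purity and mean.\<close>
  have quotient: "(- 4 * a * r\<^sup>2 - n * (- 4 * r * b)) / (r\<^sup>2 * r\<^sup>2) = - 4 * (a / r\<^sup>2 - n / r\<^sup>2 * (b / r))"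
    if "0 < r" for a b n r :: real
    using that by (simp add: divide_simps power2_eq_square) algebra
  have "(?r t)\<^sup>2 \<noteq> 0" using r[OF t] by simp
  then have "((\<lambda>t. (norm (X t))\<^sup>2 / (?r t)\<^sup>2) has_real_derivative
      - 4 * (Re (trace (G ** R ** R)) - purity R * expect G R)) (at t within {0..\<tau>})"
    unfolding moments unfolding R_def purity_eq[OF t]
    by (rule DERIV_cong[OF DERIV_divide[OF dn dr2] quotient[OF r[OF t]]])
  then show ?thesis
    by (rule has_field_derivative_transform_within[OF _ zero_less_one t]) (simp add: purity_eq)
qed

end

subsection \<open>Comparison of purities\<close>

text \<open>The factor \<open>a < 1\<close> keeps the argument away from the endpoints, which
  \<open>u\<close> may reach. Replacing \<open>u\<close> by \<open>a * u\<close> only enlarges the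
  square root in the bound on \<open>u'\<close>, so the derivative of
  \<open>arcsin (a * u t)\<close> is still bounded by \<open>f\<close>.\<close>

lemma arcsin_comparison:
  fixes u :: "real \<Rightarrow> real"
  assumes \<tau>: "0 \<le> \<tau>"
    and deriv: "\<And>t. t \<in> {0..\<tau>} \<Longrightarrow> (u has_real_derivative u' t) (at t within {0..\<tau>})"
    and u1: "\<And>t. t \<in> {0..\<tau>} \<Longrightarrow> \<bar>u t\<bar> \<le> 1"
    and u': "\<And>t. t \<in> {0..\<tau>} \<Longrightarrow> \<bar>u' t\<bar> \<le> f t * sqrt (1 - (u t)\<^sup>2)"
    and f: "f integrable_on {0..\<tau>}" "\<And>t. t \<in> {0..\<tau>} \<Longrightarrow> 0 \<le> f t"
    and a: "0 < a" "a < 1"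
  shows "\<bar>arcsin (a * u \<tau>) - arcsin (a * u 0)\<bar> \<le> integral {0..\<tau>} f"
proof -
  define h' where "h' t = a * u' t / sqrt (1 - (a * u t)\<^sup>2)" for t
  have abs_less: "\<bar>a * u t\<bar> < 1" if "t \<in> {0..\<tau>}" for t
  proof -
    have "\<bar>a * u t\<bar> \<le> a" using a u1[OF that] by (simp add: abs_mult mult_left_le)
    then show ?thesis using a by simp
  qed
  have "(h' has_integral arcsin (a * u \<tau>) - arcsin (a * u 0)) {0..\<tau>}"
  proof (rule fundamental_theorem_of_calculus[OF \<tau>])
    fix t assume t: "t \<in> {0..\<tau>}"
    have "((\<lambda>t. arcsin (a * u t)) has_real_derivative
        inverse (sqrt (1 - (a * u t)\<^sup>2)) * (a * u' t)) (at t within {0..\<tau>})"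
      using abs_less[OF t]
      by (intro DERIV_chain2[OF DERIV_arcsin] DERIV_cmult deriv t) (auto simp: abs_less_iff)
    then show "((\<lambda>t. arcsin (a * u t)) has_vector_derivative h' t) (at t within {0..\<tau>})"
      by (simp add: has_real_derivative_iff_has_vector_derivative h'_def field_simps)
  qed
  moreover have "\<bar>h' t\<bar> \<le> f t" if t: "t \<in> {0..\<tau>}" for t
  proof -
    have sq: "(a * u t)\<^sup>2 < 1" using abs_less[OF t] by (simp add: abs_square_less_1)
    have "(a * u t)\<^sup>2 \<le> 1 * (u t)\<^sup>2"
      unfolding power_mult_distrib using a by (intro mult_right_mono) (auto simp: power_le_one)
    then have "f t * sqrt (1 - (u t)\<^sup>2) \<le> f t * sqrt (1 - (a * u t)\<^sup>2)"
      using f(2)[OF t] by (intro mult_left_mono) auto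
    with u'[OF t] have "\<bar>u' t\<bar> \<le> f t * sqrt (1 - (a * u t)\<^sup>2)" by simp
    then have "a * \<bar>u' t\<bar> \<le> 1 * (f t * sqrt (1 - (a * u t)\<^sup>2))"
      using a by (intro mult_mono) auto
    then show ?thesis
      using sq a by (simp add: h'_def abs_mult abs_divide divide_le_eq)
  qed
  ultimately show ?thesis
    using integral_norm_bound_integral[of h' "{0..\<tau>}" f] f(1)
    by (simp add: has_integral_iff)
qed

text \<open>A difference of sines is twice the sine of the half difference times a cosine. The half
  difference is at most \<open>\<theta> / 2\<close>, hence in the range where sine increases.
  Bounding \<open>a * \<bar>x - y\<bar>\<close> for every \<open>a\<close> in (0,1) gives the limit
  case.\<close>

lemma abs_diff_le_of_arcsin_diff_le:
  fixes x y \<theta> :: real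
  assumes \<theta>: "0 \<le> \<theta>" "\<theta> \<le> pi"
    and le: "\<And>a. 0 < a \<Longrightarrow> a < 1 \<Longrightarrow> \<bar>arcsin (a * x) - arcsin (a * y)\<bar> \<le> \<theta>"
    and x: "\<bar>x\<bar> \<le> 1" and y: "\<bar>y\<bar> \<le> 1"
  shows "\<bar>x - y\<bar> \<le> 2 * sin (\<theta> / 2)"
proof (rule field_le_mult_one_interval)
  fix a :: real assume a: "0 < a" "a < 1"
  have ax: "\<bar>a * x\<bar> \<le> 1" and ay: "\<bar>a * y\<bar> \<le> 1"
    using a x y by (simp_all add: abs_mult mult_le_one)
  let ?d = "(arcsin (a * x) - arcsin (a * y)) / 2"
  have "a * x - a * y = sin (arcsin (a * x)) - sin (arcsin (a * y))"
    using ax ay by (simp add: abs_le_iff)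
  also have "\<dots> = 2 * sin ?d * cos ((arcsin (a * x) + arcsin (a * y)) / 2)"
    by (rule sin_diff_sin)
  finally have "\<bar>a * x - a * y\<bar> = 2 * \<bar>sin ?d\<bar> * \<bar>cos ((arcsin (a * x) + arcsin (a * y)) / 2)\<bar>"
    by (simp add: abs_mult)
  also have "\<dots> \<le> 2 * \<bar>sin ?d\<bar> * 1" by (intro mult_left_mono) auto
  also have "\<bar>sin ?d\<bar> = sin \<bar>?d\<bar>"
  proof -
    have "0 \<le> sin \<bar>?d\<bar>" using le[OF a] \<theta> by (intro sin_ge_zero) auto
    moreover have "sin \<bar>?d\<bar> = sin ?d \<or> sin \<bar>?d\<bar> = - sin ?d"
      unfolding sin_minus[symmetric] by (metis abs_if)
    ultimately show ?thesis by linarith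
  qed
  also have "sin \<bar>?d\<bar> \<le> sin (\<theta> / 2)"
    using le[OF a] \<theta> by (intro sin_monotone_2pi_le) auto
  finally show "a * \<bar>x - y\<bar> \<le> 2 * sin (\<theta> / 2)"
    using a by (simp add: abs_mult flip: right_diff_distrib)
qed

theorem mainTheorem9:
  fixes H \<Gamma> \<rho> :: "real \<Rightarrow> complex^'n^'n" and \<tau> :: real
  assumes "\<tau> > 0"
    and "\<And>t. t \<in> {0..\<tau>} \<Longrightarrow> hermitian (H t)"
    and "\<And>t. t \<in> {0..\<tau>} \<Longrightarrow> hermitian (\<Gamma> t)"
    and "continuous_on {0..\<tau>} H"
    and "continuous_on {0..\<tau>} \<Gamma>"
    and "density_operator (\<rho> 0)"
    and "\<And>t. t \<in> {0..\<tau>} \<Longrightarrow>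
           (\<rho> has_vector_derivative
             cscale (- \<i>) (nonherm_hamiltonian (H t) (\<Gamma> t) ** \<rho> t
                           - \<rho> t ** dagger (nonherm_hamiltonian (H t) (\<Gamma> t))))
           (at t within {0..\<tau>})"
    and "integral {0..\<tau>} (\<lambda>t. std_dev (\<Gamma> t) (normalized (\<rho> t))) \<le> pi / 2"
  shows "2 * sin (integral {0..\<tau>} (\<lambda>t. std_dev (\<Gamma> t) (normalized (\<rho> t))))
           \<ge> \<bar>purity (normalized (\<rho> \<tau>)) - purity (normalized (\<rho> 0))\<bar>"
proof -
  define K where "K t = cscale (- \<i>) (nonherm_hamiltonian (H t) (\<Gamma> t))" for t
  define \<Delta> where "\<Delta> t = std_dev (\<Gamma> t) (normalized (\<rho> t))" for t
  define P where "P t = purity (normalized (\<rho> t))" for t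
  define P' where "P' t = - 4 * (Re (trace (\<Gamma> t ** normalized (\<rho> t) ** normalized (\<rho> t)))
      - P t * expect (\<Gamma> t) (normalized (\<rho> t)))" for t
  have cscale_linear: "linear (cscale c :: complex^'n^'n \<Rightarrow> _)" for c
    by (rule linearI) (simp_all add: vec_eq_iff ring_distribs)
  have contK: "continuous_on {0..\<tau>} K"
    unfolding K_def nonherm_hamiltonian_def
    by (intro bounded_linear.continuous_on[OF cscale_linear[unfolded linear_conv_bounded_linear]]
        continuous_intros assms)
  then obtain c where c: "\<And>t. t \<in> {0..\<tau>} \<Longrightarrow> norm (K t) \<le> c"
    using compact_imp_bounded[OF compact_continuous_image[OF contK compact_Icc]]
    unfolding bounded_iff by blast
  have KG: "K t + dagger (K t) = - (2 *\<^sub>R \<Gamma> t)" if "t \<in> {0..\<tau>}" for t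
  proof -
    have "cnj (H t $ j $ i) = H t $ i $ j" "cnj (\<Gamma> t $ j $ i) = \<Gamma> t $ i $ j" for i j
      using assms(2,3)[OF that] by (metis dagger_nth hermitian_def)+
    then show ?thesis
      by (simp add: vec_eq_iff K_def nonherm_hamiltonian_def algebra_simps scaleR_conv_of_real)
  qed
  interpret congruence_flow K \<rho> \<tau> c
  proof
    fix t assume t: "t \<in> {0..\<tau>}"
    \<comment> \<open>The factor \<open>- \<i>\<close> is absorbed into \<open>K\<close>;
      conjugating it turns the commutator-like difference into a sum.\<close>
    have "cscale (- \<i>) (nonherm_hamiltonian (H t) (\<Gamma> t) ** \<rho> t
        - \<rho> t ** dagger (nonherm_hamiltonian (H t) (\<Gamma> t))) = K t ** \<rho> t + \<rho> t ** dagger (K t)"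
      by (simp add: vec_eq_iff K_def matrix_matrix_mult_def sum_distrib_left right_diff_distrib
          sum_negf sum_subtractf mult_ac)
    with assms(7)[OF t] show "(\<rho> has_vector_derivative K t ** \<rho> t + \<rho> t ** dagger (K t)) (at t within {0..\<tau>})"
      by simp
  qed (rule c)
  have dens: "density_operator (normalized (\<rho> t))" if "t \<in> {0..\<tau>}" for t
    by (rule density_operator_normalized[OF assms(6) that])
  have P_bounds: "0 \<le> P t" "P t \<le> 1" if "t \<in> {0..\<tau>}" for t
    using purity_le_1[OF dens[OF that]] dens[OF that]
    by (simp_all add: P_def purity_hermitian density_operator_def)
  have \<Delta>_nonneg: "0 \<le> \<Delta> t" if "t \<in> {0..\<tau>}" for t
    using variance_nonneg[OF dens[OF that] assms(3)[OF that]] by (simp add: \<Delta>_def std_dev_def)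
  have cont\<Delta>: "continuous_on {0..\<tau>} \<Delta>"
    unfolding \<Delta>_def std_dev_def expect_def
    by (intro continuous_intros bounded_linear.continuous_on[OF bounded_linear_Re_trace]
        continuous_on_normalized assms)
  then have int: "\<Delta> integrable_on {0..\<tau>}" by (rule integrable_continuous_interval)
  define \<theta> where "\<theta> = integral {0..\<tau>} \<Delta>"
  have \<theta>: "0 \<le> \<theta>" "\<theta> \<le> pi / 2"
    using assms(8) integral_nonneg[OF int \<Delta>_nonneg] by (simp_all add: \<theta>_def \<Delta>_def[abs_def])
  have "\<bar>P \<tau> - P 0\<bar> \<le> 2 * sin \<theta>"
  proof (cases "\<theta> \<le> pi / 4")
    case True
    have P_deriv: "(P has_real_derivative P' t) (at t within {0..\<tau>})" if "t \<in> {0..\<tau>}" for t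
      using purity_deriv[OF assms(6) that KG[OF that]] by (simp add: P_def[abs_def] P'_def)
    \<comment> \<open>For u = 2 P - 1, the variance factor P (1 - P) is a quarter of 1 - u^2, which
      is the shape that arcsin integrates.\<close>
    have P'_bound: "\<bar>2 * P' t\<bar> \<le> 4 * \<Delta> t * sqrt (1 - (2 * P t - 1)\<^sup>2)" if t: "t \<in> {0..\<tau>}" for t
    proof -
      have "1 - (2 * P t - 1)\<^sup>2 = 2\<^sup>2 * (P t * (1 - P t))" by algebra
      then have "sqrt (1 - (2 * P t - 1)\<^sup>2) = 2 * sqrt (P t * (1 - P t))"
        by (simp add: real_sqrt_mult)
      then show ?thesis
        using covariance_purity_bound[OF dens[OF t] assms(3)[OF t]]
        by (simp add: P'_def P_def \<Delta>_def abs_mult)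
    qed
    \<comment> \<open>The arcsine moves by at most \<open>4 * \<theta>\<close>, and this must not
      exceed pi; hence the case split at \<open>pi / 4\<close>.\<close>
    have "\<bar>(2 * P \<tau> - 1) - (2 * P 0 - 1)\<bar> \<le> 2 * sin (4 * \<theta> / 2)"
    proof (rule abs_diff_le_of_arcsin_diff_le)
      fix a :: real assume a: "0 < a" "a < 1"
      have "\<bar>arcsin (a * (2 * P \<tau> - 1)) - arcsin (a * (2 * P 0 - 1))\<bar>
          \<le> integral {0..\<tau>} (\<lambda>t. 4 * \<Delta> t)"
      proof (rule arcsin_comparison[where u' = "\<lambda>t. 2 * P' t"])
        show "((\<lambda>t. 2 * P t - 1) has_real_derivative 2 * P' t) (at t within {0..\<tau>})"
          if "t \<in> {0..\<tau>}" for t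
          using P_deriv[OF that] by (auto intro!: derivative_eq_intros)
      qed (use P_bounds P'_bound \<Delta>_nonneg int a assms(1) in
          \<open>auto simp: abs_le_iff intro: integrable_on_mult_right\<close>)
      then show "\<bar>arcsin (a * (2 * P \<tau> - 1)) - arcsin (a * (2 * P 0 - 1))\<bar> \<le> 4 * \<theta>"
        by (simp add: \<theta>_def)
    qed (use True \<theta> P_bounds[of 0] P_bounds[of \<tau>] assms(1) in auto)
    then have "\<bar>P \<tau> - P 0\<bar> \<le> sin (2 * \<theta>)" by simp
    also have "\<dots> = 2 * sin \<theta> * cos \<theta>" by (rule sin_double)
    also have "\<dots> \<le> 2 * sin \<theta> * 1"
      using \<theta> by (intro mult_left_mono) (auto intro: sin_ge_zero)
    finally show ?thesis by simp
  next
    case False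
    have "\<bar>P \<tau> - P 0\<bar> \<le> 1"
      using P_bounds[of 0] P_bounds[of \<tau>] assms(1) by auto
    \<comment> \<open>Beyond \<open>pi / 4\<close> the trivial bound suffices, since 2 sin(pi/4) is
      the square root of 2.\<close>
    also have "1 \<le> 2 * sin (pi / 4)"
      by (simp add: sin_45)
    also have "\<dots> \<le> 2 * sin \<theta>"
      using False \<theta> by (intro mult_left_mono sin_monotone_2pi_le) auto
    finally show ?thesis .
  qed
  then show ?thesis by (simp add: P_def \<theta>_def \<Delta>_def[abs_def])
qed

end
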